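(* For every command $C$ and all $P,Q\subseteq\Sigma$, interpreted in the Boolean semiring: $\vDash\langle P\rangle\,C\,\langle\lozenge Q\rangle$ holds iff $P\subseteq\langle C\rangle Q$, iff the Lisbon triple $\langle\!\langle P\rangle\!\rangle\,C\,\langle\!\langle Q\rangle\!\rangle$ is valid.
   Context: Work in the Boolean semiring $\langle\{0,1\},\lor,\land,0,1\rangle$ (top element $\top=1$). Let $\Sigma$ be a set of program states and $\natural\notin\Sigma$ a distinguished element representing nontermination, $\Sigma_\natural=\Sigma\cup\{\natural\}$. Weighting functions $m:\Sigma_\natural\to\{0,1\}$ are identified with subsets of $\Sigma_\natural$ (their supports $\mathrm{supp}(m)$); the mass $|m|$ is $1$ iff the support is nonempty. The command $C$ has denotation $\llbracket C\rrbracket:\Sigma\to\mathcal P(\Sigma_\natural)$ (the set of possible outcomes, with $\natural$ meaning possible divergence), lifted by $\llbracket C\rrbracket^\dagger(S)=\bigcup_{\sigma\in S\cap\Sigma}\llbracket C\rrbracket(\sigma)\cup(S\cap\{\natural\})$. As a precondition, $P\subseteq\Sigma$ denotes $P^{(1)}=\{m\mid|m|=1,\ \mathrm{supp}(m)\subseteq P\}$. $\lozenge Q=\{m\mid\mathrm{supp}(m)\cap Q\neq\emptyset\}$. $\vDash\langle\varphi\rangle C\langle\psi\rangle$ iff $\llbracket C\rrbracket^\dagger(m)\in\psi$ for every $m\in\varphi$. The weakest possible precondition is $\langle C\rangle Q=\{\sigma\in\Sigma\mid\llbracket C\rrbracket(\sigma)\cap Q\neq\emptyset\}$. The Lisbon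 (backwards under-approximate) triple $\langle\!\langle P\rangle\!\rangle C\langle\!\langle Q\rangle\!\rangle$ is valid iff every $\sigma\in P$ has some terminating outcome of $C$ lying in $Q$, i.e. $\llbracket C\rrbracket(\sigma)\cap Q\ne\emptyset$. *)

theory Defs
  imports Main
begin

text \<open>
  \<^typ>\<open>'s\<close> is the set of program states.  Weighting functions over the Boolean semiring are
  identified with subsets of \<open>'s outcome\<close>, so that each is its own support; the two semiring
  elements 0 and 1 are \<^term>\<open>False\<close> and \<^term>\<open>True\<close>.
\<close>

datatype 's outcome = State 's | Diverge

type_synonym 's weighting = "'s outcome set"

type_synonym 's denotation = "'s \<Rightarrow> 's weighting"

type_synonym 's assertion = "'s weighting set"

definition mass :: "'s weighting \<Rightarrow> bool" where
  "mass m \<longleftrightarrow> m \<noteq> {}"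

definition lift :: "'s denotation \<Rightarrow> 's weighting \<Rightarrow> 's weighting" where
  "lift d m = (\<Union>\<sigma> \<in> {\<sigma>. State \<sigma> \<in> m}. d \<sigma>) \<union> (m \<inter> {Diverge})"

text \<open>The assertion \<open>P\<^sup>(\<^sup>1\<^sup>)\<close>, which is what a set of states means as a precondition.\<close>

definition surely :: "'s set \<Rightarrow> 's assertion" where
  "surely P = {m. mass m = True \<and> m \<subseteq> State ` P}"

definition possibly :: "'s set \<Rightarrow> 's assertion" where
  "possibly Q = {m. m \<inter> State ` Q \<noteq> {}}"

definition outcome_triple :: "'s assertion \<Rightarrow> 's denotation \<Rightarrow> 's assertion \<Rightarrow> bool" where
  "outcome_triple \<phi> d \<psi> \<longleftrightarrow> (\<forall>m \<in> \<phi>. lift d m \<in> \<psi>)"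

definition weakest_possible_pre :: "'s denotation \<Rightarrow> 's set \<Rightarrow> 's set" where
  "weakest_possible_pre d Q = {\<sigma>. d \<sigma> \<inter> State ` Q \<noteq> {}}"

definition lisbon_triple :: "'s set \<Rightarrow> 's denotation \<Rightarrow> 's set \<Rightarrow> bool" where
  "lisbon_triple P d Q \<longleftrightarrow> (\<forall>\<sigma> \<in> P. \<exists>\<tau> \<in> Q. State \<tau> \<in> d \<sigma>)"

end

theory Submission
  imports Defs
begin

text \<open>All three conditions amount to a pointwise one: \<open>d \<sigma>\<close> meets
  \<open>Q\<close> for each \<sigma> in \<open>P\<close>. Testing the triple on singletons gives
  this (\<open>lift_singleton_State\<close>). Conversely, a weighting satisfying the precondition
  contains some such \<open>State \<sigma>\<close> (\<open>surely_contains_singleton\<close>), and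
  the other outcomes in its lift cannot undo the hit.\<close>

lemma lift_singleton_State: "lift d {State \<sigma>} = d \<sigma>"
  by (auto simp: lift_def)

lemma lift_mono: "m \<subseteq> m' \<Longrightarrow> lift d m \<subseteq> lift d m'"
  by (auto simp: lift_def)

lemma singleton_in_surely_iff: "{State \<sigma>} \<in> surely P \<longleftrightarrow> \<sigma> \<in> P"
  by (auto simp: surely_def mass_def)

text \<open>The mass condition is what rules out the empty weighting, whose lift is empty and so can
  never reach \<open>Q\<close>.\<close>

lemma surely_contains_singleton:
  assumes "m \<in> surely P"
  obtains \<sigma> where "\<sigma> \<in> P" and "{State \<sigma>} \<subseteq> m"
  using assms by (auto simp: surely_def mass_def)

lemma possibly_upward_closed: "m \<in> possibly Q \<Longrightarrow> m \<subseteq> m' \<Longrightarrow> m' \<in> possibly Q"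
  by (auto simp: possibly_def)

lemma weakest_possible_pre_iff: "\<sigma> \<in> weakest_possible_pre d Q \<longleftrightarrow> d \<sigma> \<in> possibly Q"
  by (simp add: weakest_possible_pre_def possibly_def)

text \<open>Since \<open>possibly Q\<close> is upward closed and lifting is monotone, only the minimal elements of
  \<open>surely P\<close>, the singletons, matter.\<close>

lemma outcome_triple_possibly_iff:
  "outcome_triple (surely P) d (possibly Q) \<longleftrightarrow> P \<subseteq> weakest_possible_pre d Q"
proof
  assume triple: "outcome_triple (surely P) d (possibly Q)"
  show "P \<subseteq> weakest_possible_pre d Q"
  proof
    fix \<sigma> assume "\<sigma> \<in> P"
    then have "lift d {State \<sigma>} \<in> possibly Q"
      using triple by (simp add: outcome_triple_def singleton_in_surely_iff)
    then show "\<sigma> \<in> weakest_possible_pre d Q"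
      by (simp add: lift_singleton_State weakest_possible_pre_iff)
  qed
next
  assume sub: "P \<subseteq> weakest_possible_pre d Q"
  show "outcome_triple (surely P) d (possibly Q)"
    unfolding outcome_triple_def
  proof
    fix m assume "m \<in> surely P"
    then obtain \<sigma> where "\<sigma> \<in> P" and "{State \<sigma>} \<subseteq> m"
      by (rule surely_contains_singleton)
    then have "d \<sigma> \<in> possibly Q" and "d \<sigma> \<subseteq> lift d m"
      using sub lift_mono[of "{State \<sigma>}" m d]
      by (auto simp: weakest_possible_pre_iff lift_singleton_State)
    then show "lift d m \<in> possibly Q"
      by (rule possibly_upward_closed)
  qed
qed

text \<open>Termination is implicit on the right: the image of \<open>Q\<close> under
  \<open>State\<close> excludes \<open>Diverge\<close>, so a common element with
  \<open>d \<sigma>\<close> is a terminating outcome.\<close>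

lemma lisbon_triple_iff: "lisbon_triple P d Q \<longleftrightarrow> P \<subseteq> weakest_possible_pre d Q"
  by (fastforce simp: lisbon_triple_def weakest_possible_pre_def)

text \<open>Commands matter only through their denotations, so the syntax stays abstract and
  \<open>sem\<close> is an arbitrary function.\<close>

theorem mainTheorem4:
  fixes sem :: "'c \<Rightarrow> 's denotation"
    and C :: 'c
    and P Q :: "'s set"
  shows "(outcome_triple (surely P) (sem C) (possibly Q) \<longleftrightarrow> P \<subseteq> weakest_possible_pre (sem C) Q)
    \<and> (P \<subseteq> weakest_possible_pre (sem C) Q \<longleftrightarrow> lisbon_triple P (sem C) Q)"
  by (simp add: outcome_triple_possibly_iff lisbon_triple_iff)

end
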